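(* Let $G_1,G_2,\ldots,G_n$ ($n\ge 3$) be a finite sequence of pairwise disjoint connected graphs and let $x_i\in V(G_i)$ for $1\le i\le n$. Let $G$ be the circuit of the graphs $\{G_i\}_{i=1}^n$ with respect to the vertices $\{x_i\}_{i=1}^n$, obtained by identifying the vertex $x_i$ of the graph $G_i$ with the $i$-th vertex of the cycle graph $C_n$. Then $$ABC_{GG}(G)<(|E(G)|-n)+\sum_{i=1}^{n}ABC_{GG}(G_i)+\sqrt{\frac{|V(G)|-2}{|V(G_1)||V(G_n)|}}+\sum_{i=1}^{n-1}\sqrt{\frac{|V(G)|-2}{|V(G_i)||V(G_{i+1})|}}.$$
   Context: All graphs are finite and simple. For an edge $uv$ of a graph $G$, $n_u(uv,G)$ is the number of vertices of $G$ strictly closer (in graph distance in $G$) to $u$ than to $v$, and $n_v(uv,G)$ is defined analogously; equidistant vertices are not counted. $ABC_{GG}(G)=\sum_{uv\in E(G)}\sqrt{\frac{n_u(uv,G)+n_v(uv,G)-2}{n_u(uv,G)n_v(uv,G)}}$ (Graovac-Ghorbani index). *)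

theory Defs
  imports Complex_Main "HOL-Library.Extended_Nat" "HOL-Library.Disjoint_Sets"
begin

record 'a sgraph =
  verts :: "'a set"
  edges :: "'a set set"

definition simple_graph :: "'a sgraph \<Rightarrow> bool" where
  "simple_graph G \<longleftrightarrow> finite (verts G) \<and> edges G \<subseteq> {e. e \<subseteq> verts G \<and> card e = 2}"

definition adj :: "'a sgraph \<Rightarrow> 'a rel" where
  "adj G = {(u, v). {u, v} \<in> edges G}"

definition connected_graph :: "'a sgraph \<Rightarrow> bool" where
  "connected_graph G \<longleftrightarrow>
     simple_graph G \<and> verts G \<noteq> {} \<and> (\<forall>u\<in>verts G. \<forall>v\<in>verts G. (u, v) \<in> (adj G)\<^sup>*)"

text \<open>A pair belongs to the \<open>k\<close>-th power of the adjacency relation iff it is joined by a walk of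
  length \<open>k\<close>. The distance is \<open>\<infinity>\<close> when there is no walk.\<close>

definition gdist :: "'a sgraph \<Rightarrow> 'a \<Rightarrow> 'a \<Rightarrow> enat" where
  "gdist G u v = (INF k \<in> {k. (u, v) \<in> adj G ^^ k}. enat k)"

text \<open>\<open>n_closer G u v\<close> is $n_u(uv, G)$; $n_v(uv, G)$ is \<open>n_closer G v u\<close>.\<close>

definition n_closer :: "'a sgraph \<Rightarrow> 'a \<Rightarrow> 'a \<Rightarrow> nat" where
  "n_closer G u v = card {w \<in> verts G. gdist G w u < gdist G w v}"

text \<open>Edges are unordered, so the summand of the index is written symmetrically in the two
  endpoints; the inner sum and product range over the single other endpoint \<open>v\<close>. Lemma
  \<open>gg_term_edge\<close> gives the usual form.\<close>

definition gg_term :: "'a sgraph \<Rightarrow> 'a set \<Rightarrow> real" where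
  "gg_term G e =
     sqrt (((\<Sum>u\<in>e. \<Sum>v\<in>e - {u}. real (n_closer G u v)) - 2) /
           (\<Prod>u\<in>e. \<Prod>v\<in>e - {u}. real (n_closer G u v)))"

lemma gg_term_edge:
  assumes "u \<noteq> v"
  shows "gg_term G {u, v} =
    sqrt ((real (n_closer G u v) + real (n_closer G v u) - 2) /
          (real (n_closer G u v) * real (n_closer G v u)))"
proof -
  have "{u, v} - {u} = {v}" "{u, v} - {v} = {u}"
    using assms by auto
  then show ?thesis
    using assms by (simp add: gg_term_def)
qed

definition ABC_GG :: "'a sgraph \<Rightarrow> real" where
  "ABC_GG G = (\<Sum>e\<in>edges G. gg_term G e)"

text \<open>The definition is meant for \<open>n \<ge> 3\<close>.\<close>

definition cycle_graph :: "nat \<Rightarrow> nat sgraph" where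
  "cycle_graph n =
     \<lparr>verts = {1..n}, edges = insert {n, 1} {{i, i + 1} |i. 1 \<le> i \<and> i < n}\<rparr>"

text \<open>The circuit of \<open>Gs 1, \<dots>, Gs n\<close> with respect to \<open>x 1, \<dots>, x n\<close>: vertex \<open>i\<close> of the cycle is
  identified with \<open>x i\<close>, and \<open>x i\<close> represents the identified vertex. This is the intended graph when
  the \<open>Gs i\<close> are pairwise disjoint and \<open>x i\<close> is a vertex of \<open>Gs i\<close>.\<close>

definition circuit :: "nat \<Rightarrow> (nat \<Rightarrow> 'a sgraph) \<Rightarrow> (nat \<Rightarrow> 'a) \<Rightarrow> 'a sgraph" where
  "circuit n Gs x =
     \<lparr>verts = (\<Union>i\<in>{1..n}. verts (Gs i)) \<union> x ` verts (cycle_graph n),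
      edges = (\<Union>i\<in>{1..n}. edges (Gs i)) \<union> (\<lambda>e. x ` e) ` edges (cycle_graph n)\<rparr>"

end

theory Submission imports Defs begin

text \<open>
  The edges of the circuit fall into two kinds, and each kind is estimated on its own.

  An edge inside some \<open>Gs i\<close> is charged the constant \<open>1\<close>: for all positive integers \<open>a\<close> and \<open>b\<close> one
  has \<open>a + b - 2 < a b\<close>, so every summand of the index of any graph is below \<open>1\<close>
  (\<open>gg_term_less_1\<close>). The circuit has exactly \<open>|E(G)| - n\<close> edges inside the \<open>Gs i\<close>, so the first
  term of the bound already pays for all of them, and the nonnegative indices of the \<open>Gs i\<close> only
  enlarge the right-hand side.

  For a cycle edge joining \<open>x i\<close> and \<open>x j\<close>, a walk can leave \<open>Gs i\<close> only through \<open>x i\<close>. Hence all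
  vertices of \<open>Gs i\<close> are closer to \<open>x i\<close> than to \<open>x j\<close>, and symmetrically for \<open>Gs j\<close>. This bounds the
  denominator of the summand from below by \<open>|V(Gs i)| |V(Gs j)|\<close>, while the numerator is at most
  \<open>|V(G)| - 2\<close>. As \<open>n \<ge> 3\<close>, there is a vertex outside both graphs. Either it is equidistant
  from the two ends, and the numerator bound is strict, or it is counted on one side, and the
  denominator bound is strict (\<open>gg_term_gates_less\<close>). Summing over the \<open>n \<ge> 3\<close> cycle edges keeps the
  inequality strict, even when the \<open>Gs i\<close> have no edges at all.
\<close>

section \<open>Distances and the size of a summand\<close>

lemma gdist_self [simp]: "gdist G u u = 0"
proof -
  have "gdist G u u \<le> enat 0"
    unfolding gdist_def by (rule INF_lower) simp
  then show ?thesis by (simp flip: zero_enat_def)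
qed

lemma gdist_pos:
  assumes "u \<noteq> v"
  shows "0 < gdist G u v"
proof -
  have "enat 1 \<le> gdist G u v"
    unfolding gdist_def
  proof (rule INF_greatest)
    fix k assume "k \<in> {k. (u, v) \<in> adj G ^^ k}"
    then have "k \<noteq> 0" using assms by (cases k) auto
    then show "enat 1 \<le> enat k" by simp
  qed
  moreover have "0 < enat 1" by (simp add: zero_enat_def)
  ultimately show ?thesis by (rule less_le_trans[rotated])
qed

lemma gdist_le: "(u, v) \<in> adj G ^^ k \<Longrightarrow> gdist G u v \<le> enat k"
  unfolding gdist_def by (rule INF_lower) simp

lemma n_closer_pos:
  assumes "finite (verts G)" "u \<in> verts G" "u \<noteq> v"
  shows "1 \<le> n_closer G u v"
proof -
  have "u \<in> {w \<in> verts G. gdist G w u < gdist G w v}"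
    using assms gdist_pos[of u v G] by simp
  then have "n_closer G u v \<noteq> 0"
    unfolding n_closer_def using assms(1) by auto
  then show ?thesis by simp
qed

lemma n_closer_add_le:
  assumes "finite (verts G)"
  shows "n_closer G u v + n_closer G v u \<le> card (verts G)"
proof -
  let ?A = "{w \<in> verts G. gdist G w u < gdist G w v}"
  let ?B = "{w \<in> verts G. gdist G w v < gdist G w u}"
  have "card ?A + card ?B = card (?A \<union> ?B)"
    by (rule card_Un_disjoint [symmetric]) (use assms in auto)
  also have "\<dots> \<le> card (verts G)"
    by (rule card_mono) (use assms in auto)
  finally show ?thesis by (simp add: n_closer_def)
qed

lemma simple_graph_edgeE:
  assumes "simple_graph G" "e \<in> edges G"
  obtains u v where "e = {u, v}" "u \<noteq> v" "u \<in> verts G" "v \<in> verts G" "finite (verts G)"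
proof -
  have "e \<subseteq> verts G" "card e = 2" "finite (verts G)"
    using assms by (auto simp: simple_graph_def)
  moreover from this obtain u v where "e = {u, v}" "u \<noteq> v" by (auto simp: card_2_iff)
  ultimately show ?thesis using that by auto
qed

lemma simple_graph_finite_edges:
  assumes "simple_graph G"
  shows "finite (edges G)"
proof (rule finite_subset)
  show "edges G \<subseteq> Pow (verts G)" using assms by (auto simp: simple_graph_def)
  show "finite (Pow (verts G))" using assms by (simp add: simple_graph_def)
qed

text \<open>The difference \<open>a b - (a + b - 2)\<close> is \<open>(a - 1) (b - 1) + 1\<close>.\<close>

lemma gg_term_less_1:
  assumes "simple_graph G" "e \<in> edges G"
  shows "gg_term G e < 1"
proof -
  obtain u v where e: "e = {u, v}" "u \<noteq> v" "u \<in> verts G" "v \<in> verts G" "finite (verts G)"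
    using assms by (rule simple_graph_edgeE)
  define a b where "a = real (n_closer G u v)" and "b = real (n_closer G v u)"
  have ab: "1 \<le> a" "1 \<le> b"
    using n_closer_pos[of G u v] n_closer_pos[of G v u] e by (simp_all add: a_def b_def)
  then have "0 \<le> (a - 1) * (b - 1)" by simp
  then have "a + b - 2 < a * b" by (simp add: algebra_simps)
  moreover have "0 < a * b" using ab by simp
  ultimately have "(a + b - 2) / (a * b) < 1" by (simp add: divide_less_eq)
  then show ?thesis
    using e(1,2) by (simp add: gg_term_edge a_def b_def)
qed

lemma gg_term_nonneg:
  assumes "simple_graph G" "e \<in> edges G"
  shows "0 \<le> gg_term G e"
proof -
  obtain u v where e: "e = {u, v}" "u \<noteq> v" "u \<in> verts G" "v \<in> verts G" "finite (verts G)"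
    using assms by (rule simple_graph_edgeE)
  then show ?thesis
    using n_closer_pos[of G u v] n_closer_pos[of G v u] by (simp add: gg_term_edge)
qed

lemma ABC_GG_nonneg: "simple_graph G \<Longrightarrow> 0 \<le> ABC_GG G"
  unfolding ABC_GG_def by (intro sum_nonneg gg_term_nonneg)

section \<open>Sets of vertices with a single exit\<close>

text \<open>Abstracts the position of \<open>Gs i\<close> inside the circuit, with \<open>c\<close> for \<open>x i\<close>. Reachability makes the
  distances to \<open>c\<close> finite, so that they are strictly below an infinite distance to a vertex outside \<open>C\<close>.\<close>

definition gate :: "'a sgraph \<Rightarrow> 'a set \<Rightarrow> 'a \<Rightarrow> bool" where
  "gate G C c \<longleftrightarrow> C \<subseteq> verts G \<and> c \<in> C \<and> (\<forall>w\<in>C. (w, c) \<in> (adj G)\<^sup>*) \<and>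
     (\<forall>p\<in>C. \<forall>q. q \<notin> C \<longrightarrow> (p, q) \<in> adj G \<longrightarrow> p = c)"

text \<open>Strip edges from the end of the walk until one leaves \<open>C\<close>: that edge starts at \<open>c\<close>, and it is
  missing from the remaining walk, which is therefore strictly shorter.\<close>

lemma walk_through_gate:
  assumes "gate G C c" "w \<in> C"
  shows "(w, y) \<in> adj G ^^ k \<Longrightarrow> y \<notin> C \<Longrightarrow> \<exists>m<k. (w, c) \<in> adj G ^^ m"
proof (induction k arbitrary: y)
  case 0
  then show ?case using assms(2) by simp
next
  case (Suc k)
  then obtain z where z: "(w, z) \<in> adj G ^^ k" "(z, y) \<in> adj G" by auto
  show ?case
  proof (cases "z \<in> C")
    case True
    then have "z = c" using assms(1) z(2) Suc.prems(2) by (auto simp: gate_def)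
    then show ?thesis using z(1) by auto
  next
    case False
    then show ?thesis using Suc.IH[OF z(1)] less_SucI by blast
  qed
qed

lemma gdist_gate_less:
  assumes "gate G C c" "w \<in> C" "y \<notin> C"
  shows "gdist G w c < gdist G w y"
proof (cases "{k. (w, y) \<in> adj G ^^ k} = {}")
  case True
  then have "gdist G w y = \<infinity>" by (simp add: gdist_def top_enat_def)
  moreover obtain m where m: "(w, c) \<in> adj G ^^ m"
    using assms(1,2) by (auto simp: gate_def rtrancl_power)
  ultimately show ?thesis using gdist_le[OF m] by (cases "gdist G w c") auto
next
  case False
  \<comment> \<open>the infimum of a nonempty set of lengths is attained by a shortest walk\<close>
  then obtain k\<^sub>0 where "enat k\<^sub>0 \<in> enat ` {k. (w, y) \<in> adj G ^^ k}" by auto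
  then have "gdist G w y \<in> enat ` {k. (w, y) \<in> adj G ^^ k}"
    unfolding gdist_def by (rule wellorder_InfI)
  then obtain k where k: "gdist G w y = enat k" "(w, y) \<in> adj G ^^ k" by auto
  obtain m where m: "m < k" "(w, c) \<in> adj G ^^ m"
    using walk_through_gate[OF assms(1,2) k(2) assms(3)] by auto
  have "gdist G w c \<le> enat m" by (rule gdist_le[OF m(2)])
  also have "\<dots> < enat k" using m(1) by simp
  finally show ?thesis using k(1) by simp
qed

lemma card_le_n_closer_gate:
  assumes "finite (verts G)" "gate G C c" "y \<notin> C"
  shows "card C \<le> n_closer G c y"
  unfolding n_closer_def
proof (rule card_mono)
  show "finite {w \<in> verts G. gdist G w c < gdist G w y}" using assms(1) by simp
  show "C \<subseteq> {w \<in> verts G. gdist G w c < gdist G w y}"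
    using assms(2) gdist_gate_less[OF assms(2) _ assms(3)] by (auto simp: gate_def)
qed

text \<open>A vertex outside \<open>A \<union> B\<close> makes one of two estimates strict. Let \<open>p\<close> and \<open>q\<close> be the
  numbers of vertices closer to \<open>a\<close> and to \<open>b\<close>. If every vertex is counted, that is \<open>p + q = |V(G)|\<close>, then \<open>p + q > |A| + |B|\<close>, so the product
  \<open>p q\<close> exceeds \<open>|A| |B|\<close>; otherwise \<open>p + q - 2 < |V(G)| - 2\<close>.\<close>

lemma gg_term_gates_less:
  assumes fin: "finite (verts G)"
    and A: "gate G A a" and B: "gate G B b"
    and disj: "A \<inter> B = {}" and out: "z \<in> verts G" "z \<notin> A" "z \<notin> B"
  shows "gg_term G {a, b} < sqrt ((real (card (verts G)) - 2) / (real (card A) * real (card B)))"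
proof -
  define p q N where "p = n_closer G a b" and "q = n_closer G b a" and "N = card (verts G)"
  have mem: "a \<in> A" "b \<in> B" "A \<subseteq> verts G" "B \<subseteq> verts G" using A B by (auto simp: gate_def)
  then have ne: "b \<notin> A" "a \<notin> B" "a \<noteq> b" using disj by auto
  have finAB: "finite A" "finite B" using mem fin finite_subset by blast+
  have pos: "0 < card A" "0 < card B" using mem finAB by (auto simp: card_gt_0_iff)
  have le: "card A \<le> p" "card B \<le> q"
    unfolding p_def q_def
    by (rule card_le_n_closer_gate[OF fin A ne(1)], rule card_le_n_closer_gate[OF fin B ne(2)])
  have pq: "p + q \<le> N" unfolding p_def q_def N_def by (rule n_closer_add_le[OF fin])
  have "card (insert z (A \<union> B)) \<le> N"
    unfolding N_def by (rule card_mono) (use fin mem out in auto)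
  then have AB: "card A + card B < N"
    using out finAB disj by (simp add: card_Un_disjoint)
  have prod_le: "card A * card B \<le> p * q" using le by (rule mult_le_mono)
  have "(real p + real q - 2) / (real p * real q) < (real N - 2) / (real (card A) * real (card B))"
  proof (cases "p + q = N")
    case True
    have "card A * card B < p * q"
    proof (cases "card A < p")
      case True
      then have "card A * card B < p * card B" using pos by simp
      also have "\<dots> \<le> p * q" using le by simp
      finally show ?thesis .
    next
      case False
      then have "card A = p" using le by simp
      moreover from this have "card B < q" using AB True by linarith
      ultimately show ?thesis using pos by simp
    qed
    then have "real (card A) * real (card B) < real p * real q"
      by (metis of_nat_less_iff of_nat_mult)
    moreover have "0 < real N - 2" using AB pos by linarith
    moreover have "real p + real q - 2 = real N - 2" using True by linarith
    moreover have "0 < real (card A) * real (card B)" using pos by simp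
    ultimately show ?thesis by (intro frac_less2) auto
  next
    case False
    then have "real p + real q - 2 < real N - 2" using pq by linarith
    moreover have "0 \<le> real p + real q - 2" using le pos by linarith
    moreover have "real (card A) * real (card B) \<le> real p * real q"
      using prod_le by (metis of_nat_le_iff of_nat_mult)
    moreover have "0 < real (card A) * real (card B)" using pos by simp
    ultimately show ?thesis by (intro frac_less) auto
  qed
  then show ?thesis using ne(3) by (simp add: gg_term_edge p_def q_def N_def)
qed

section \<open>The two kinds of edges of a circuit\<close>

definition cycle_succ :: "nat \<Rightarrow> nat \<Rightarrow> nat" where
  "cycle_succ n i = (if i = n then 1 else i + 1)"

lemma cycle_succ_props:
  assumes "n \<ge> 3" "i \<in> {1..n}"
  shows "cycle_succ n i \<in> {1..n}" "cycle_succ n i \<noteq> i"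
  using assms by (auto simp: cycle_succ_def)

lemma edges_cycle_graph:
  assumes "n \<ge> 1"
  shows "edges (cycle_graph n) = (\<lambda>i. {i, cycle_succ n i}) ` {1..n}"
proof -
  have "{1..n} = insert n {i. 1 \<le> i \<and> i < n}" using assms by auto
  then show ?thesis by (auto simp: cycle_graph_def cycle_succ_def image_iff)
qed

text \<open>Fails for \<open>n = 2\<close>, where both indices give the same edge.\<close>

lemma cycle_edge_inj:
  assumes "n \<ge> 3"
  shows "inj_on (\<lambda>i. {i, cycle_succ n i}) {1..n}"
  using assms by (auto simp: inj_on_def cycle_succ_def doubleton_eq_iff split: if_splits)

locale graph_circuit =
  fixes n :: nat and Gs :: "nat \<Rightarrow> 'a sgraph" and x :: "nat \<Rightarrow> 'a"
  assumes n3: "n \<ge> 3"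
    and conn: "i \<in> {1..n} \<Longrightarrow> connected_graph (Gs i)"
    and disj: "disjoint_family_on (\<lambda>i. verts (Gs i)) {1..n}"
    and x_in: "i \<in> {1..n} \<Longrightarrow> x i \<in> verts (Gs i)"
begin

abbreviation "G \<equiv> circuit n Gs x"
abbreviation "inner_edges \<equiv> \<Union>i\<in>{1..n}. edges (Gs i)"
abbreviation "cycle_edge i \<equiv> {x i, x (cycle_succ n i)}"

lemma simple: "i \<in> {1..n} \<Longrightarrow> simple_graph (Gs i)"
  using conn by (simp add: connected_graph_def)

lemma vertex_owner_unique:
  "i \<in> {1..n} \<Longrightarrow> j \<in> {1..n} \<Longrightarrow> v \<in> verts (Gs i) \<Longrightarrow> v \<in> verts (Gs j) \<Longrightarrow> i = j"
  using disj unfolding disjoint_family_on_def by blast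

lemma x_owner: "i \<in> {1..n} \<Longrightarrow> j \<in> {1..n} \<Longrightarrow> x i \<in> verts (Gs j) \<Longrightarrow> i = j"
  using vertex_owner_unique x_in by blast

lemma x_inj: "inj_on x {1..n}"
  by (rule inj_onI) (metis x_in x_owner)

lemma verts_G: "verts G = (\<Union>i\<in>{1..n}. verts (Gs i))"
  using x_in by (auto simp: circuit_def cycle_graph_def)

lemma edges_G: "edges G = inner_edges \<union> cycle_edge ` {1..n}"
  using n3 by (simp add: circuit_def edges_cycle_graph image_image)

lemma cycle_edge_inj_on: "inj_on cycle_edge {1..n}"
proof -
  have "inj_on ((`) x) ((\<lambda>i. {i, cycle_succ n i}) ` {1..n})"
  proof (rule inj_on_subset[OF inj_on_image_Pow[OF x_inj]])
    show "(\<lambda>i. {i, cycle_succ n i}) ` {1..n} \<subseteq> Pow {1..n}"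
      using cycle_succ_props(1)[OF n3] by blast
  qed
  then have "inj_on ((`) x \<circ> (\<lambda>i. {i, cycle_succ n i})) {1..n}"
    by (rule comp_inj_on[OF cycle_edge_inj[OF n3]])
  then show ?thesis by (simp add: comp_def)
qed

lemma inner_cycle_disjoint: "inner_edges \<inter> cycle_edge ` {1..n} = {}"
proof -
  have False if i: "i \<in> {1..n}" and j: "j \<in> {1..n}" and e: "cycle_edge i \<in> edges (Gs j)" for i j
  proof -
    have "x i \<in> verts (Gs j)" "x (cycle_succ n i) \<in> verts (Gs j)"
      using simple[OF j] e by (auto simp: simple_graph_def)
    then show False using x_owner i j cycle_succ_props[OF n3 i] by metis
  qed
  then show ?thesis by blast
qed

lemma x_in_G: "i \<in> {1..n} \<Longrightarrow> x i \<in> verts G"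
  unfolding verts_G using x_in by blast

lemma finite_verts_G: "finite (verts G)"
  using simple by (simp add: verts_G simple_graph_def)

lemma finite_inner_edges: "finite inner_edges"
  using simple simple_graph_finite_edges by blast

lemma simple_graph_G: "simple_graph G"
proof -
  have "e \<subseteq> verts G \<and> card e = 2" if e: "e \<in> edges G" for e
  proof (cases "e \<in> inner_edges")
    case True
    then show ?thesis using simple unfolding verts_G simple_graph_def by blast
  next
    case False
    then obtain i where i: "i \<in> {1..n}" "e = cycle_edge i" using e edges_G by auto
    have "x i \<noteq> x (cycle_succ n i)"
      using x_inj i(1) cycle_succ_props[OF n3 i(1)] by (metis inj_onD)
    then show ?thesis
      using i x_in_G cycle_succ_props(1)[OF n3 i(1)] by simp
  qed
  then show ?thesis using finite_verts_G by (auto simp: simple_graph_def)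
qed

lemma card_edges_G: "card (edges G) = card inner_edges + n"
proof -
  have "card (edges G) = card inner_edges + card (cycle_edge ` {1..n})"
    unfolding edges_G by (rule card_Un_disjoint[OF finite_inner_edges _ inner_cycle_disjoint]) simp
  moreover have "card (cycle_edge ` {1..n}) = n"
    by (subst card_image[OF cycle_edge_inj_on]) simp
  ultimately show ?thesis by simp
qed

lemma gate_component:
  assumes i: "i \<in> {1..n}"
  shows "gate G (verts (Gs i)) (x i)"
  unfolding gate_def
proof (intro conjI ballI allI impI)
  show "verts (Gs i) \<subseteq> verts G" using i by (auto simp: verts_G)
  show "x i \<in> verts (Gs i)" using x_in i .
  fix w assume w: "w \<in> verts (Gs i)"
  have "adj (Gs i) \<subseteq> adj G" using i by (auto simp: adj_def edges_G)
  moreover have "(w, x i) \<in> (adj (Gs i))\<^sup>*"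
    using conn[OF i] w x_in[OF i] by (auto simp: connected_graph_def)
  ultimately show "(w, x i) \<in> (adj G)\<^sup>*" using rtrancl_mono by blast
next
  fix p q assume p: "p \<in> verts (Gs i)" and q: "q \<notin> verts (Gs i)" and pq: "(p, q) \<in> adj G"
  \<comment> \<open>an inner edge at \<open>p\<close> stays inside \<open>Gs i\<close>, so \<open>pq\<close> is a cycle edge and \<open>p\<close> is one of the \<open>x j\<close>\<close>
  have "{p, q} \<notin> inner_edges"
  proof
    assume "{p, q} \<in> inner_edges"
    then obtain j where j: "j \<in> {1..n}" "{p, q} \<in> edges (Gs j)" by auto
    then have "p \<in> verts (Gs j)" "q \<in> verts (Gs j)"
      using simple[OF j(1)] by (auto simp: simple_graph_def)
    then show False using vertex_owner_unique[OF i j(1) p] q by auto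
  qed
  then obtain j where j: "j \<in> {1..n}" "{p, q} = cycle_edge j"
    using pq by (auto simp: adj_def edges_G)
  then have "p = x j \<or> p = x (cycle_succ n j)" by (auto simp: doubleton_eq_iff)
  then show "p = x i"
    using x_owner[OF _ i] p j(1) cycle_succ_props(1)[OF n3 j(1)] by auto
qed

lemma cycle_edge_term_less:
  assumes i: "i \<in> {1..n}"
  shows "gg_term G (cycle_edge i) <
    sqrt ((real (card (verts G)) - 2) /
      (real (card (verts (Gs i))) * real (card (verts (Gs (cycle_succ n i))))))"
proof -
  let ?j = "cycle_succ n i"
  note j = cycle_succ_props[OF n3 i]
  have "\<not> {1..n} \<subseteq> {i, ?j}"
  proof
    assume "{1..n} \<subseteq> {i, ?j}"
    then have "card {1..n} \<le> card {i, ?j}" by (rule card_mono[rotated]) simp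
    then show False using n3 j(2) by simp
  qed
  then obtain k where k: "k \<in> {1..n}" "k \<noteq> i" "k \<noteq> ?j" by blast
  show ?thesis
  proof (rule gg_term_gates_less[OF finite_verts_G gate_component[OF i] gate_component[OF j(1)]])
    show "verts (Gs i) \<inter> verts (Gs ?j) = {}" using vertex_owner_unique i j by blast
    show "x k \<in> verts G" using x_in_G k(1) .
    show "x k \<notin> verts (Gs i)" "x k \<notin> verts (Gs ?j)" using x_owner i j(1) k by blast+
  qed
qed

lemma sum_inner_terms_le: "(\<Sum>e\<in>inner_edges. gg_term G e) \<le> real (card inner_edges)"
proof -
  have "(\<Sum>e\<in>inner_edges. gg_term G e) \<le> (\<Sum>e\<in>inner_edges. 1)"
    by (rule sum_mono) (use gg_term_less_1[OF simple_graph_G] edges_G in \<open>auto intro: less_imp_le\<close>)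
  then show ?thesis by simp
qed

lemma ABC_GG_circuit_less:
  "ABC_GG G < real (card inner_edges) + (\<Sum>i = 1..n. sqrt ((real (card (verts G)) - 2) /
      (real (card (verts (Gs i))) * real (card (verts (Gs (cycle_succ n i)))))))"
proof -
  have "ABC_GG G = (\<Sum>e\<in>inner_edges. gg_term G e) + (\<Sum>e\<in>cycle_edge ` {1..n}. gg_term G e)"
    unfolding ABC_GG_def edges_G
    by (rule sum.union_disjoint[OF finite_inner_edges _ inner_cycle_disjoint]) simp
  also have "(\<Sum>e\<in>cycle_edge ` {1..n}. gg_term G e) = (\<Sum>i = 1..n. gg_term G (cycle_edge i))"
    by (rule sum.reindex_cong[OF cycle_edge_inj_on]) auto
  also have "\<dots> < (\<Sum>i = 1..n. sqrt ((real (card (verts G)) - 2) /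
      (real (card (verts (Gs i))) * real (card (verts (Gs (cycle_succ n i)))))))"
    by (rule sum_strict_mono) (use n3 cycle_edge_term_less in auto)
  finally show ?thesis using sum_inner_terms_le by linarith
qed

end

section \<open>The bound for the circuit\<close>

theorem theorem2p10:
  fixes n :: nat and Gs :: "nat \<Rightarrow> 'a sgraph" and x :: "nat \<Rightarrow> 'a" and G :: "'a sgraph"
  assumes "n \<ge> 3"
    and "\<And>i. i \<in> {1..n} \<Longrightarrow> connected_graph (Gs i)"
    and "disjoint_family_on (\<lambda>i. verts (Gs i)) {1..n}"
    and "\<And>i. i \<in> {1..n} \<Longrightarrow> x i \<in> verts (Gs i)"
    and "G = circuit n Gs x"
  shows "ABC_GG G <
    (real (card (edges G)) - real n) + (\<Sum>i = 1..n. ABC_GG (Gs i))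
    + sqrt ((real (card (verts G)) - 2) / (real (card (verts (Gs 1))) * real (card (verts (Gs n)))))
    + (\<Sum>i = 1..n - 1. sqrt ((real (card (verts G)) - 2) /
          (real (card (verts (Gs i))) * real (card (verts (Gs (i + 1)))))))"
proof -
  interpret graph_circuit n Gs x
    using assms(1-4) by unfold_locales
  define t where "t i j = sqrt ((real (card (verts G)) - 2) /
    (real (card (verts (Gs i))) * real (card (verts (Gs j)))))" for i j
  have "{1..n} = insert n {1..n - 1}" using assms(1) by auto
  then have "(\<Sum>i = 1..n. t i (cycle_succ n i)) = t n 1 + (\<Sum>i = 1..n - 1. t i (cycle_succ n i))"
    using assms(1) by (simp add: cycle_succ_def)
  also have "(\<Sum>i = 1..n - 1. t i (cycle_succ n i)) = (\<Sum>i = 1..n - 1. t i (i + 1))"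
    by (rule sum.cong) (use assms(1) in \<open>auto simp: cycle_succ_def\<close>)
  also have "t n 1 = t 1 n" by (simp add: t_def mult.commute)
  finally have cyc: "(\<Sum>i = 1..n. t i (cycle_succ n i)) = t 1 n + (\<Sum>i = 1..n - 1. t i (i + 1))" .
  have "0 \<le> (\<Sum>i = 1..n. ABC_GG (Gs i))"
    by (intro sum_nonneg ABC_GG_nonneg simple)
  moreover have "real (card (edges G)) - real n = real (card inner_edges)"
    using card_edges_G assms(5) by simp
  moreover have "ABC_GG G < real (card inner_edges) + (\<Sum>i = 1..n. t i (cycle_succ n i))"
    using ABC_GG_circuit_less unfolding t_def assms(5) .
  ultimately have "ABC_GG G < (real (card (edges G)) - real n) + (\<Sum>i = 1..n. ABC_GG (Gs i))
      + t 1 n + (\<Sum>i = 1..n - 1. t i (i + 1))"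
    using cyc by linarith
  then show ?thesis unfolding t_def .
qed

end
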